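(* In the setting described in the context (a $3$-dimensional Calabi-Yau manifold $X$ with $T^2$-symmetry given by data $W$, $\alpha_1,\alpha_2$, and the special Lagrangian $3$-torus fibration $f:X\to B$), the following hold for every $b\in B$. With respect to the frame $(\eta_1,\eta_2,\zeta)$, the metric induced on the fibre $F_b=f^{-1}(b)$ has the form $$g=\begin{pmatrix}W&0\\0&\det W\end{pmatrix}.$$ With respect to the frame $\Xi=(\Xi_1,\Xi_2,\Xi_3)$, McLean's metric $G=\left(\langle\Xi_j,\Xi_k\rangle_{L^2(F_b)}\right)_{j,k}$ has the form $$G=\int_0^{\kappa}g^{-1}\,dx .$$
   Context: Setting. Let $B\subseteq\mathbb{R}^3$ be open, let $u=x+iy$ be the coordinate on $\mathbb{C}$, let $S^1=\mathbb{R}/\mathbb{Z}$, and let $$\tilde X=\{(\phi_1,\phi_2,u,t_1,t_2)\in S^1\times S^1\times\mathbb{C}\times\mathbb{R}\times\mathbb{R}\;:\;(t_1,t_2,\operatorname{Im}u)\in B\}.$$ Let $T^2$ act on $\tilde X$ by translations of $(\phi_1,\phi_2)$ and write $\eta_j=\partial/\partial\phi_j$. Let $W=(w_{jk})$ be a $2\times2$ positive definite symmetric matrix of real smooth functions, with inverse $W^{-1}=(w^{jk})$, and let $\alpha_1,\alpha_2$ be complex-valued smooth functions, all depending only on $(u,t_1,t_2)$ and all periodic in $x=\operatorname{Re}u$ with period $\kappa>0$. Put $$\theta_j=\alpha_j\,du-\overline{\alpha}_j\,d\overline{u}+i\,d\phi_j\quad(j=1,2),$$ $$\omega=\frac{i}{2}\det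 W^{-1}\,du\wedge d\overline{u}-i\sum_{j}\theta_j\wedge dt_j,\qquad \Omega=-\Big(\sum_k w^{1k}dt_k-\theta_1\Big)\wedge\Big(\sum_k w^{2k}dt_k-\theta_2\Big)\wedge du .$$ It is assumed that $(\Omega,\omega)$ is a Calabi-Yau structure on $\tilde X$: $\Omega$ and $\omega$ are closed, $\Omega$ is a nowhere vanishing holomorphic $3$-form for the complex structure it determines, and $\omega$ is a Ricci-flat Kähler form with $\omega^{3}/3!=(-1)^{3}(i/2)^{3}\,\Omega\wedge\overline{\Omega}$. (This is the general local form of a $3$-dimensional Calabi-Yau structure with $T^2$-action that is Hamiltonian with moment map $(t_1,t_2)$ and preserves $\Omega$, and with reduced holomorphic $1$-form $du$.) Let $X=\tilde X/\kappa\mathbb{Z}$, where $\kappa\mathbb{Z}$ acts by translations on $x$; $(\Omega,\omega)$ descends to a Calabi-Yau structure on $X$. The map $$f:X\to B,\qquad f(\phi_1,\phi_2,u,t_1,t_2)=(t_1,t_2,\operatorname{Im}u)$$ is a special Lagrangian $3$-torus fibration ($\omega$ and $\operatorname{Im}\Omega$ restrict to zero on the fibres). Write $F_b=f^{-1}(b)$. Frame of vector fields on $F_b$: $\eta_1,\eta_2$ and $$\zeta=\det W\Big(\frac{\partial}{\partial x}-2\sum_{k=1}^{2}\operatorname{Im}(\alpha_k)\,\eta_k\Big).$$ Frame of $1$-forms on $F_b$: $\Xi_k=(\iota_{\partial/\partial t_k}\omega)|_{F_b}$ for $k=1,2$ and $\Xi_3=(\iota_{\partial/\partial y}\omega)|_{F_b}$;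 these are harmonic $1$-forms on $F_b$. McLean's metric is the $L^2$ inner product $\langle\theta,\theta'\rangle_{L^2(F_b)}=\int_{F_b}\theta\wedge\star\theta'$ on harmonic $1$-forms, with $\star$ the Hodge star of the metric on $F_b$ induced by the Kähler metric of $X$. The integral of a matrix is taken entrywise, at fixed $(t_1,t_2,y)=b$. *)

theory Defs
  imports "HOL-Analysis.Analysis" "HOL-Combinatorics.Permutations"
begin

section \<open>Smooth functions and differential forms on open subsets of a Euclidean space\<close>

primrec Ck_on :: "nat \<Rightarrow> 'a::real_normed_vector set \<Rightarrow> ('a \<Rightarrow> 'b::real_normed_vector) \<Rightarrow> bool" where
  "Ck_on 0 S f \<longleftrightarrow> continuous_on S f"
| "Ck_on (Suc k) S f \<longleftrightarrow> (\<forall>p\<in>S. f differentiable (at p)) \<and>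
     (\<forall>v. Ck_on k S (\<lambda>p. frechet_derivative f (at p) v))"

text \<open>Meant for open \<open>S\<close> and finite-dimensional domains.\<close>

definition smooth_on :: "'a::real_normed_vector set \<Rightarrow> ('a \<Rightarrow> 'b::real_normed_vector) \<Rightarrow> bool" where
  "smooth_on S f \<longleftrightarrow> (\<forall>k. Ck_on k S f)"

text \<open>
  A \<open>k\<close>-form sends a point and an argument sequence \<open>v 0, v 1, \<dots>\<close> of tangent vectors to a
  scalar. The degree \<open>k\<close> is carried separately; only \<open>v 0, \<dots>, v (k - 1)\<close> matter.
\<close>

type_synonym ('a, 'c) form = "'a \<Rightarrow> (nat \<Rightarrow> 'a) \<Rightarrow> 'c"

definition differential_form ::
    "'a::euclidean_space set \<Rightarrow> nat \<Rightarrow> ('a, 'c::real_normed_field) form \<Rightarrow> bool" where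
  "differential_form U k A \<longleftrightarrow>
     (\<forall>v. smooth_on U (\<lambda>p. A p v)) \<and>
     (\<forall>p\<in>U.
        (\<forall>v w. (\<forall>i<k. v i = w i) \<longrightarrow> A p v = A p w) \<and>
        (\<forall>i<k. \<forall>v. linear (\<lambda>x. A p (v(i := x)))) \<and>
        (\<forall>v i j. i < k \<and> j < k \<and> i \<noteq> j \<and> v i = v j \<longrightarrow> A p v = 0))"

text \<open>
  Normalisation of the wedge product and of the exterior derivative:
  \<open>(a \<and> b)(v, w) = a v * b w - a w * b v\<close> for 1-forms, and
  \<open>da(v, w) = D\<^sub>v (a w) - D\<^sub>w (a v)\<close> for constant \<open>v, w\<close>.
\<close>

definition wedge :: "nat \<Rightarrow> nat \<Rightarrow> ('a, 'c::real_normed_field) form \<Rightarrow> ('a, 'c) form \<Rightarrow> ('a, 'c) form" where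
  "wedge k l A A' p v =
     (\<Sum>\<sigma> | \<sigma> permutes {..<k + l}.
        of_int (sign \<sigma>) * A p (\<lambda>i. v (\<sigma> i)) * A' p (\<lambda>i. v (\<sigma> (k + i)))) / (fact k * fact l)"

definition ext_deriv :: "nat \<Rightarrow> ('a::real_normed_vector, 'c::real_normed_field) form \<Rightarrow> ('a, 'c) form" where
  "ext_deriv k A p v =
     (\<Sum>i\<le>k. (- 1) ^ i *
        frechet_derivative (\<lambda>q. A q (\<lambda>j. if j < i then v j else v (Suc j))) (at p) (v i))"

definition dfun :: "('a::real_normed_vector \<Rightarrow> 'c::real_normed_field) \<Rightarrow> ('a, 'c) form" where
  "dfun f = ext_deriv 0 (\<lambda>p v. f p)"

definition interior_product :: "('a \<Rightarrow> 'a) \<Rightarrow> ('a, 'c) form \<Rightarrow> ('a, 'c) form" where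
  "interior_product X A p v = A p (case_nat (X p) v)"

definition pullback ::
    "('b::real_normed_vector \<Rightarrow> 'a::real_normed_vector) \<Rightarrow> ('a, 'c) form \<Rightarrow> ('b, 'c) form" where
  "pullback F A s v = A (F s) (\<lambda>i. frechet_derivative F (at s) (v i))"


section \<open>Ricci curvature\<close>

text \<open>
  A Riemannian metric is given by its bilinear form at each point. The arguments \<open>v, w, z\<close> below
  stand for constant vector fields, which commute, so \<open>christoffel g p v w\<close> is the Levi-Civita
  derivative of \<open>w\<close> along \<open>v\<close> (Koszul formula).
\<close>

definition christoffel ::
    "('a::euclidean_space \<Rightarrow> 'a \<Rightarrow> 'a \<Rightarrow> real) \<Rightarrow> 'a \<Rightarrow> 'a \<Rightarrow> 'a \<Rightarrow> 'a" where
  "christoffel g p v w = (THE c. \<forall>z. g p c z =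
     (frechet_derivative (\<lambda>q. g q w z) (at p) v +
      frechet_derivative (\<lambda>q. g q v z) (at p) w -
      frechet_derivative (\<lambda>q. g q v w) (at p) z) / 2)"

definition riemann ::
    "('a::euclidean_space \<Rightarrow> 'a \<Rightarrow> 'a \<Rightarrow> real) \<Rightarrow> 'a \<Rightarrow> 'a \<Rightarrow> 'a \<Rightarrow> 'a \<Rightarrow> 'a" where
  "riemann g p v w z =
     frechet_derivative (\<lambda>q. christoffel g q w z) (at p) v -
     frechet_derivative (\<lambda>q. christoffel g q v z) (at p) w +
     christoffel g p v (christoffel g p w z) - christoffel g p w (christoffel g p v z)"

definition ricci :: "('a::euclidean_space \<Rightarrow> 'a \<Rightarrow> 'a \<Rightarrow> real) \<Rightarrow> 'a \<Rightarrow> 'a \<Rightarrow> 'a \<Rightarrow> real" where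
  "ricci g p w z = (\<Sum>b\<in>Basis. riemann g p b w z \<bullet> b)"


section \<open>Calabi-Yau structures in complex dimension 3\<close>

text \<open>
  The complex structure determined by a complex 3-form \<open>\<Omega>\<close> is the one for which \<open>\<Omega>\<close> has type
  (3,0), that is, for which \<open>\<Omega>\<close> is complex linear in its first argument.
\<close>

definition complex_structure :: "('a::euclidean_space, complex) form \<Rightarrow> 'a \<Rightarrow> 'a \<Rightarrow> 'a" where
  "complex_structure \<Omega> p = (THE J. linear J \<and> (\<forall>v. J (J v) = - v) \<and>
     (\<forall>x v. \<Omega> p (case_nat (J x) v) = \<i> * \<Omega> p (case_nat x v)))"

definition holomorphic_chart ::
    "('a::euclidean_space \<Rightarrow> 'a \<Rightarrow> 'a) \<Rightarrow> 'a set \<Rightarrow> ('a \<Rightarrow> complex^3) \<Rightarrow> bool" where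
  "holomorphic_chart J V z \<longleftrightarrow>
     open V \<and> inj_on z V \<and> open (z ` V) \<and> smooth_on V z \<and> smooth_on (z ` V) (inv_into V z) \<and>
     (\<forall>p\<in>V. \<forall>v. frechet_derivative z (at p) (J p v) = \<i> *s frechet_derivative z (at p) v)"

definition holomorphic_fun :: "(complex^3) set \<Rightarrow> (complex^3 \<Rightarrow> complex) \<Rightarrow> bool" where
  "holomorphic_fun S h \<longleftrightarrow>
     (\<forall>w\<in>S. h differentiable (at w) \<and>
        (\<forall>c v. frechet_derivative h (at w) (c *s v) = c * frechet_derivative h (at w) v))"

text \<open>
  The first conjunct of the existence statement makes \<open>J\<close> an integrable complex structure; the
  others say that \<open>\<Omega>\<close> is \<open>h dz\<^sub>1 \<and> dz\<^sub>2 \<and> dz\<^sub>3\<close> locally, with \<open>h\<close> holomorphic and nowhere zero.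
\<close>

definition nonvanishing_holomorphic_3form ::
    "'a::euclidean_space set \<Rightarrow> ('a \<Rightarrow> 'a \<Rightarrow> 'a) \<Rightarrow> ('a, complex) form \<Rightarrow> bool" where
  "nonvanishing_holomorphic_3form U J \<Omega> \<longleftrightarrow>
     (\<forall>p\<in>U. \<exists>V z h. p \<in> V \<and> V \<subseteq> U \<and> holomorphic_chart J V z \<and>
        holomorphic_fun (z ` V) h \<and> (\<forall>w\<in>z ` V. h w \<noteq> 0) \<and>
        (\<forall>q\<in>V. \<forall>v. \<Omega> q v = h (z q) *
           wedge 2 1 (wedge 1 1 (dfun (\<lambda>p. z p $ 1)) (dfun (\<lambda>p. z p $ 2))) (dfun (\<lambda>p. z p $ 3)) q v))"

definition kaehler_metric ::
    "('a::euclidean_space, complex) form \<Rightarrow> ('a, complex) form \<Rightarrow> 'a \<Rightarrow> 'a \<Rightarrow> 'a \<Rightarrow> real" where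
  "kaehler_metric \<Omega> \<omega> p v w = Re (\<omega> p ((!) [v, complex_structure \<Omega> p w]))"

definition calabi_yau3 ::
    "'a::euclidean_space set \<Rightarrow> ('a, complex) form \<Rightarrow> ('a, complex) form \<Rightarrow> bool" where
  "calabi_yau3 U \<Omega> \<omega> \<longleftrightarrow>
     differential_form U 3 \<Omega> \<and> differential_form U 2 \<omega> \<and>
     (\<forall>p\<in>U. \<forall>v. ext_deriv 3 \<Omega> p v = 0) \<and>
     (\<forall>p\<in>U. \<forall>v. ext_deriv 2 \<omega> p v = 0) \<and>
     nonvanishing_holomorphic_3form U (complex_structure \<Omega>) \<Omega> \<and>
     (\<forall>p\<in>U. \<forall>v. Im (\<omega> p v) = 0) \<and>
     (\<forall>p\<in>U. \<forall>v w. \<omega> p ((!) [complex_structure \<Omega> p v, complex_structure \<Omega> p w]) = \<omega> p ((!) [v, w])) \<and>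
     (\<forall>p\<in>U. \<forall>v. v \<noteq> 0 \<longrightarrow> kaehler_metric \<Omega> \<omega> p v v > 0) \<and>
     (\<forall>p\<in>U. \<forall>v w. ricci (kaehler_metric \<Omega> \<omega>) p v w = 0) \<and>
     (\<forall>p\<in>U. \<forall>v. wedge 4 2 (wedge 2 2 \<omega> \<omega>) \<omega> p v / fact 3 =
        (- 1) ^ 3 * (\<i> / 2) ^ 3 * wedge 3 3 \<Omega> (\<lambda>p v. cnj (\<Omega> p v)) p v)"


section \<open>Hodge star on 1-forms in dimension 3\<close>

text \<open>
  On open subsets of \<open>real^3\<close> with the orientation \<open>e\<^sub>1 \<and> e\<^sub>2 \<and> e\<^sub>3\<close>. The star of \<open>a\<close> is the
  contraction of the Riemannian volume form with the vector dual to \<open>a\<close>, so that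
  \<open>b \<and> \<star>a = \<langle>b, a\<rangle> vol\<close> for every 1-form \<open>b\<close>.
\<close>

definition gram :: "(real^3 \<Rightarrow> real^3 \<Rightarrow> real^3 \<Rightarrow> real) \<Rightarrow> real^3 \<Rightarrow> real^3^3" where
  "gram h s = (\<chi> i j. h s (axis i 1) (axis j 1))"

definition volume_form :: "(real^3 \<Rightarrow> real^3 \<Rightarrow> real^3 \<Rightarrow> real) \<Rightarrow> (real^3, real) form" where
  "volume_form h s v = sqrt (det (gram h s)) * det (vector [v 0, v 1, v 2] :: real^3^3)"

definition dual_vector_field ::
    "(real^3 \<Rightarrow> real^3 \<Rightarrow> real^3 \<Rightarrow> real) \<Rightarrow> (real^3, real) form \<Rightarrow> real^3 \<Rightarrow> real^3" where
  "dual_vector_field h a s = matrix_inv (gram h s) *v (\<chi> i. a s (\<lambda>_. axis i 1))"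

definition hodge_star :: "(real^3 \<Rightarrow> real^3 \<Rightarrow> real^3 \<Rightarrow> real) \<Rightarrow> (real^3, real) form \<Rightarrow> (real^3, real) form" where
  "hodge_star h a = interior_product (dual_vector_field h a) (volume_form h)"


section \<open>The total space and its torus fibration\<close>

text \<open>
  Points are \<open>(\<phi>, u, t)\<close> with \<open>\<phi> = (\<phi>\<^sub>1, \<phi>\<^sub>2)\<close>, \<open>u = x + iy\<close> and \<open>t = (t\<^sub>1, t\<^sub>2)\<close>. The angles are
  lifted to \<open>\<real>\<close>, so \<open>total_space B\<close> is the covering space of \<open>X\<close> with deck group \<open>deck \<kappa>\<close>,
  acting by translations by \<open>\<int>\<close> in \<open>\<phi>\<^sub>1\<close>, \<open>\<phi>\<^sub>2\<close> and by \<open>\<kappa>\<int>\<close> in \<open>x\<close>. Tensors on \<open>X\<close> are the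
  invariant tensors on this covering space.
\<close>

type_synonym base_pt = "complex \<times> (real^2)"
type_synonym pt = "(real^2) \<times> complex \<times> (real^2)"

definition moment_base :: "(real^3) set \<Rightarrow> base_pt set" where
  "moment_base B = {(u, t). vector [t $ 1, t $ 2, Im u] \<in> B}"

definition fibration :: "pt \<Rightarrow> real^3" where
  "fibration = (\<lambda>(\<phi>, u, t). vector [t $ 1, t $ 2, Im u])"

definition total_space :: "(real^3) set \<Rightarrow> pt set" where
  "total_space B = {p. fibration p \<in> B}"

definition deck :: "real \<Rightarrow> pt set" where
  "deck \<kappa> = {(vector [of_int m, of_int n], of_real (\<kappa> * of_int l), 0) | m n l. True}"

definition du :: "(pt, complex) form" where
  "du = dfun (\<lambda>(\<phi>, u, t). u)"

definition du_bar :: "(pt, complex) form" where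
  "du_bar = dfun (\<lambda>(\<phi>, u, t). cnj u)"

definition d\<phi> :: "2 \<Rightarrow> (pt, complex) form" where
  "d\<phi> j = dfun (\<lambda>(\<phi>, u, t). of_real (\<phi> $ j))"

definition dt :: "2 \<Rightarrow> (pt, complex) form" where
  "dt j = dfun (\<lambda>(\<phi>, u, t). of_real (t $ j))"

text \<open>
  Below, \<open>W\<close> and \<open>\<alpha>\<close> are functions of \<open>(u, t) = snd p\<close>.
\<close>

definition theta :: "(base_pt \<Rightarrow> complex^2) \<Rightarrow> 2 \<Rightarrow> (pt, complex) form" where
  "theta \<alpha> j p v = \<alpha> (snd p) $ j * du p v - cnj (\<alpha> (snd p) $ j) * du_bar p v + \<i> * d\<phi> j p v"

definition omega ::
    "(base_pt \<Rightarrow> real^2^2) \<Rightarrow> (base_pt \<Rightarrow> complex^2) \<Rightarrow> (pt, complex) form" where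
  "omega W \<alpha> p v =
     \<i> / 2 * of_real (det (matrix_inv (W (snd p)))) * wedge 1 1 du du_bar p v
     - \<i> * (\<Sum>j\<in>UNIV. wedge 1 1 (theta \<alpha> j) (dt j) p v)"

definition Omega_factor ::
    "(base_pt \<Rightarrow> real^2^2) \<Rightarrow> (base_pt \<Rightarrow> complex^2) \<Rightarrow> 2 \<Rightarrow> (pt, complex) form" where
  "Omega_factor W \<alpha> j p v =
     (\<Sum>k\<in>UNIV. of_real (matrix_inv (W (snd p)) $ j $ k) * dt k p v) - theta \<alpha> j p v"

definition Omega ::
    "(base_pt \<Rightarrow> real^2^2) \<Rightarrow> (base_pt \<Rightarrow> complex^2) \<Rightarrow> (pt, complex) form" where
  "Omega W \<alpha> p v =
     - wedge 2 1 (wedge 1 1 (Omega_factor W \<alpha> 1) (Omega_factor W \<alpha> 2)) du p v"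


section \<open>The fibres\<close>

text \<open>
  The fibre over \<open>b = (t\<^sub>1, t\<^sub>2, y)\<close> is the quotient of \<open>real^3\<close>, with coordinates
  \<open>(\<phi>\<^sub>1, \<phi>\<^sub>2, x)\<close>, by the lattice \<open>\<int> \<oplus> \<int> \<oplus> \<kappa>\<int>\<close>; tensors on it are written in these coordinates.
\<close>

definition fibre_emb :: "real^3 \<Rightarrow> real^3 \<Rightarrow> pt" where
  "fibre_emb b s = (vector [s $ 1, s $ 2], Complex (s $ 3) (b $ 3), vector [b $ 1, b $ 2])"

definition fibre_metric ::
    "(base_pt \<Rightarrow> real^2^2) \<Rightarrow> (base_pt \<Rightarrow> complex^2) \<Rightarrow> real^3 \<Rightarrow>
     real^3 \<Rightarrow> real^3 \<Rightarrow> real^3 \<Rightarrow> real" where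
  "fibre_metric W \<alpha> b s v w =
     kaehler_metric (Omega W \<alpha>) (omega W \<alpha>) (fibre_emb b s)
       (frechet_derivative (fibre_emb b) (at s) v) (frechet_derivative (fibre_emb b) (at s) w)"

definition eta :: "2 \<Rightarrow> real^3" where
  "eta k = (if k = 1 then axis 1 1 else axis 2 1)"

definition zeta ::
    "(base_pt \<Rightarrow> real^2^2) \<Rightarrow> (base_pt \<Rightarrow> complex^2) \<Rightarrow> real^3 \<Rightarrow> real^3 \<Rightarrow> real^3" where
  "zeta W \<alpha> b s = (let q = snd (fibre_emb b s) in
     det (W q) *\<^sub>R (axis 3 1 - 2 *\<^sub>R (\<Sum>k\<in>UNIV. Im (\<alpha> q $ k) *\<^sub>R eta k)))"

definition fibre_frame ::
    "(base_pt \<Rightarrow> real^2^2) \<Rightarrow> (base_pt \<Rightarrow> complex^2) \<Rightarrow> real^3 \<Rightarrow> real^3 \<Rightarrow> (real^3)^3" where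
  "fibre_frame W \<alpha> b s = vector [eta 1, eta 2, zeta W \<alpha> b s]"

text \<open>The block matrix with blocks \<open>A\<close> and \<open>det A\<close>.\<close>

definition block_metric :: "real^2^2 \<Rightarrow> real^3^3" where
  "block_metric A = vector
     [vector [A $ 1 $ 1, A $ 1 $ 2, 0],
      vector [A $ 2 $ 1, A $ 2 $ 2, 0],
      vector [0, 0, det A]]"

text \<open>The coordinate vector fields \<open>\<partial>/\<partial>t\<^sub>1\<close>, \<open>\<partial>/\<partial>t\<^sub>2\<close>, \<open>\<partial>/\<partial>y\<close>.\<close>

definition transverse_field :: "3 \<Rightarrow> pt" where
  "transverse_field j =
     (if j = 1 then (0, 0, axis 1 1) else if j = 2 then (0, 0, axis 2 1) else (0, \<i>, 0))"

text \<open>The real part only changes the type: \<open>omega\<close> is a real form with complex-typed values.\<close>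

definition Xi ::
    "(base_pt \<Rightarrow> real^2^2) \<Rightarrow> (base_pt \<Rightarrow> complex^2) \<Rightarrow> real^3 \<Rightarrow> 3 \<Rightarrow> (real^3, real) form" where
  "Xi W \<alpha> b j s v =
     Re (pullback (fibre_emb b) (interior_product (\<lambda>p. transverse_field j) (omega W \<alpha>)) s v)"

text \<open>
  Integral of a 3-form over the fibre, oriented by \<open>d\<phi>\<^sub>1 \<and> d\<phi>\<^sub>2 \<and> dx\<close>, computed on the fundamental
  domain \<open>[0,1] \<times> [0,1] \<times> [0,\<kappa>]\<close> of the lattice. (The \<open>L\<^sup>2\<close> product below does not depend on the
  orientation, since the Hodge star changes sign with it.)
\<close>

definition fibre_integral :: "real \<Rightarrow> (real^3, real) form \<Rightarrow> real" where
  "fibre_integral \<kappa> A =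
     integral (cbox 0 (vector [1, 1, \<kappa>])) (\<lambda>s. A s ((!) [axis 1 1, axis 2 1, axis 3 1]))"

definition L2_inner ::
    "real \<Rightarrow> (base_pt \<Rightarrow> real^2^2) \<Rightarrow> (base_pt \<Rightarrow> complex^2) \<Rightarrow> real^3 \<Rightarrow>
     (real^3, real) form \<Rightarrow> (real^3, real) form \<Rightarrow> real" where
  "L2_inner \<kappa> W \<alpha> b a a' =
     fibre_integral \<kappa> (wedge 1 2 a (hodge_star (fibre_metric W \<alpha> b) a'))"

definition mclean_metric ::
    "real \<Rightarrow> (base_pt \<Rightarrow> real^2^2) \<Rightarrow> (base_pt \<Rightarrow> complex^2) \<Rightarrow> real^3 \<Rightarrow> real^3^3" where
  "mclean_metric \<kappa> W \<alpha> b = (\<chi> j k. L2_inner \<kappa> W \<alpha> b (Xi W \<alpha> b j) (Xi W \<alpha> b k))"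


section \<open>Compatibility with the covering\<close>

lemma range_fibre_emb: "range (fibre_emb b) = {p. fibration p = b}"
proof (rule set_eqI)
  fix p :: pt
  obtain \<phi> u t where p: "p = (\<phi>, u, t)" by (cases p)
  have "p = fibre_emb b (vector [\<phi> $ 1, \<phi> $ 2, Re u])" if "fibration p = b"
    using that[symmetric] by (simp add: p fibration_def fibre_emb_def vec_eq_iff forall_2)
  moreover have "fibration (fibre_emb b s) = b" for s
    by (simp add: fibration_def fibre_emb_def vec_eq_iff forall_3)
  ultimately show "p \<in> range (fibre_emb b) \<longleftrightarrow> p \<in> {p. fibration p = b}" by auto
qed

lemma total_space_deck: "\<gamma> \<in> deck \<kappa> \<Longrightarrow> p + \<gamma> \<in> total_space B \<longleftrightarrow> p \<in> total_space B"
  by (cases p) (auto simp: deck_def total_space_def fibration_def)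

lemma fibre_fundamental_domain:
  assumes "\<kappa> > 0"
  shows "\<exists>!s. 0 \<le> s $ 1 \<and> s $ 1 < 1 \<and> 0 \<le> s $ 2 \<and> s $ 2 < 1 \<and> 0 \<le> s $ 3 \<and> s $ 3 < \<kappa> \<and>
           fibre_emb b s - fibre_emb b s0 \<in> deck \<kappa>"
proof -
  have deck: "fibre_emb b s - fibre_emb b s0 \<in> deck \<kappa> \<longleftrightarrow>
      s $ 1 - s0 $ 1 \<in> \<int> \<and> s $ 2 - s0 $ 2 \<in> \<int> \<and> s $ 3 / \<kappa> - s0 $ 3 / \<kappa> \<in> \<int>" for s
  proof -
    have "s $ 3 / \<kappa> - s0 $ 3 / \<kappa> = of_int l \<longleftrightarrow> s $ 3 - s0 $ 3 = \<kappa> * of_int l" for l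
      using assms by (simp add: field_simps)
    then show ?thesis
      by (auto simp: deck_def fibre_emb_def vec_eq_iff forall_2 complex_eq_iff Ints_def)
  qed
  have frac_unique: "y = frac x" if y: "0 \<le> y" "y < 1" "y - x \<in> \<int>" for x y :: real
  proof -
    obtain k where k: "y - x = of_int k" using y(3) by (auto elim: Ints_cases)
    have "\<lfloor>x\<rfloor> = - k" by (rule floor_unique) (use y k in auto)
    then show ?thesis using k by (simp add: frac_def)
  qed
  have frac_mem: "frac x - x \<in> \<int>" for x :: real
    by (simp add: frac_def)
  let ?s = "vector [frac (s0 $ 1), frac (s0 $ 2), \<kappa> * frac (s0 $ 3 / \<kappa>)] :: real^3"
  show ?thesis
  proof (rule ex1I[of _ ?s])
    show "0 \<le> ?s $ 1 \<and> ?s $ 1 < 1 \<and> 0 \<le> ?s $ 2 \<and> ?s $ 2 < 1 \<and> 0 \<le> ?s $ 3 \<and> ?s $ 3 < \<kappa> \<and>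
           fibre_emb b ?s - fibre_emb b s0 \<in> deck \<kappa>"
      using assms frac_lt_1[of "s0 $ 3 / \<kappa>"] by (simp add: deck frac_mem frac_lt_1)
  next
    fix s :: "real^3"
    assume s: "0 \<le> s $ 1 \<and> s $ 1 < 1 \<and> 0 \<le> s $ 2 \<and> s $ 2 < 1 \<and> 0 \<le> s $ 3 \<and> s $ 3 < \<kappa> \<and>
           fibre_emb b s - fibre_emb b s0 \<in> deck \<kappa>"
    have "s $ 3 / \<kappa> = frac (s0 $ 3 / \<kappa>)"
      by (rule frac_unique) (use s assms deck in auto)
    then have "s $ 3 = \<kappa> * frac (s0 $ 3 / \<kappa>)" using assms by (simp add: field_simps)
    moreover have "s $ 1 = frac (s0 $ 1)" "s $ 2 = frac (s0 $ 2)"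
      by (rule frac_unique; use s deck in auto)+
    ultimately show "s = ?s" by (simp add: vec_eq_iff forall_3)
  qed
qed

lemma dfun_linear:
  fixes f :: "'a::euclidean_space \<Rightarrow> 'c::real_normed_field"
  assumes "linear f"
  shows "dfun f p v = f (v 0)"
proof -
  have "(f has_derivative f) (at p)"
    by (rule linear_imp_has_derivative[OF assms])
  from frechet_derivative_at[OF this] show ?thesis by (simp add: dfun_def ext_deriv_def)
qed

lemma dcoord:
  "du p v = fst (snd (v 0))" "du_bar p v = cnj (fst (snd (v 0)))"
  "d\<phi> j p v = of_real (fst (v 0) $ j)" "dt j p v = of_real (snd (snd (v 0)) $ j)"
  unfolding du_def du_bar_def d\<phi>_def dt_def
  by (subst dfun_linear; auto intro!: linearI simp: case_prod_beta complex_eq_iff)+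

lemma deck_invariance:
  assumes W: "\<And>u t. (u, t) \<in> moment_base B \<Longrightarrow> W (u + of_real \<kappa>, t) = W (u, t)"
    and \<alpha>: "\<And>u t. (u, t) \<in> moment_base B \<Longrightarrow> \<alpha> (u + of_real \<kappa>, t) = \<alpha> (u, t)"
    and p: "p \<in> total_space B" and \<gamma>: "\<gamma> \<in> deck \<kappa>"
  shows "omega W \<alpha> (p + \<gamma>) v = omega W \<alpha> p v" "Omega W \<alpha> (p + \<gamma>) v = Omega W \<alpha> p v"
proof -
  obtain l :: int where l: "snd \<gamma> = (of_real (\<kappa> * of_int l), 0)" using \<gamma> unfolding deck_def by force
  obtain u t where ut: "snd p = (u, t)" by (cases "snd p")
  have base: "(u + of_real c, t) \<in> moment_base B" for c
    using p ut by (cases p) (auto simp: total_space_def fibration_def moment_base_def)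
  have step: "f (u + of_real (\<kappa> * of_int l), t) = f (u, t)"
    if f: "\<And>u t. (u, t) \<in> moment_base B \<Longrightarrow> f (u + of_real \<kappa>, t) = f (u, t)"
    for f :: "base_pt \<Rightarrow> 'x"
  proof (induction l rule: int_induct[where k = 0])
    case base
    show ?case by simp
  next
    case (step1 i)
    then show ?case using f[OF base[of "\<kappa> * of_int i"]] by (simp add: algebra_simps)
  next
    case (step2 i)
    then show ?case using f[OF base[of "\<kappa> * of_int (i - 1)"]] by (simp add: algebra_simps)
  qed
  have "W (snd (p + \<gamma>)) = W (snd p)" "\<alpha> (snd (p + \<gamma>)) = \<alpha> (snd p)"
    using step[of W, OF W] step[of \<alpha>, OF \<alpha>] by (simp_all add: l ut)
  then show "omega W \<alpha> (p + \<gamma>) v = omega W \<alpha> p v" "Omega W \<alpha> (p + \<gamma>) v = Omega W \<alpha> p v"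
    by (simp_all add: omega_def Omega_def Omega_factor_def theta_def wedge_def dcoord)
qed

end

theory Submission
  imports Defs
begin

text \<open>
  Write \<open>\<tau>\<^sub>j = d\<phi>\<^sub>j + 2 Im (\<alpha>\<^sub>j du)\<close>, so that \<open>\<theta>\<^sub>j = i \<tau>\<^sub>j\<close>, and \<open>M = W\<^sup>-\<^sup>1\<close>. The three
  factors \<open>(M dt)\<^sub>j - i \<tau>\<^sub>j\<close> and \<open>du\<close> of \<open>\<Omega>\<close> form at each point a real linear isomorphism from
  the tangent space to \<open>\<complex>\<^sup>3\<close>, and \<open>\<Omega>\<close> is minus the pullback of the determinant
  (\<open>Omega_eq_det\<close>, \<open>bij_holomorphic_coframe\<close>). The complex structure of \<open>\<Omega>\<close> is therefore
  multiplication by \<open>i\<close> transported through this isomorphism: it is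
  pointwise algebra, given by \<open>dt \<circ> J = W \<tau>\<close>, \<open>\<tau> \<circ> J = - M dt\<close> and \<open>du \<circ> J = i du\<close>.
  Since \<open>\<omega> = (det W)\<^sup>-\<^sup>1 dx \<and> dy + \<Sum>\<^sub>j \<tau>\<^sub>j \<and> dt\<^sub>j\<close>, the Kaehler metric is
  \<open>\<tau>\<^sup>T W \<tau> + (det W)\<^sup>-\<^sup>1 (dx\<^sup>2 + dy\<^sup>2) + dt\<^sup>T M dt\<close> (\<open>kaehler_metric_eq\<close>).

  On a fibre \<open>dt = dy = 0\<close>. Let \<open>C\<close> be the matrix whose rows are \<open>\<tau>\<^sub>1\<close>, \<open>\<tau>\<^sub>2\<close> and
  \<open>(det W)\<^sup>-\<^sup>1 dx\<close>, and let \<open>G\<close> be the block matrix with blocks \<open>W\<close> and \<open>det W\<close>. The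
  induced metric is \<open>C\<^sup>T G C\<close>, and \<open>C\<close> is the coframe dual to \<open>(\<eta>\<^sub>1, \<eta>\<^sub>2, \<zeta>)\<close>, which is the
  first claim.

  For the second claim, \<open>\<Xi>\<^sub>j\<close> is minus the \<open>j\<close>-th row of \<open>C\<close> (\<open>Xi_eq\<close>), so the pointwise inner
  products of the \<open>\<Xi>\<^sub>j\<close> form the matrix \<open>C (C\<^sup>T G C)\<^sup>-\<^sup>1 C\<^sup>T = G\<^sup>-\<^sup>1\<close>. As
  \<open>det C = (det W)\<^sup>-\<^sup>1\<close> and \<open>det G = (det W)\<^sup>2\<close>, the Riemannian volume is
  \<open>d\<phi>\<^sub>1 \<and> d\<phi>\<^sub>2 \<and> dx\<close> itself (\<open>det_gram_fibre_metric\<close>). So the \<open>L\<^sup>2\<close> product integrates an entry of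
  \<open>G\<^sup>-\<^sup>1\<close>, which depends on \<open>x\<close> alone, over the box \<open>[0,1] \<times> [0,1] \<times> [0,\<kappa>]\<close>; the angular
  integrals contribute 1 by Fubini (\<open>integral_box_third_coordinate\<close>).
\<close>

section \<open>Wedge products of low degree\<close>
lemma permutations_3:
  "(\<Sum>\<sigma> | \<sigma> permutes {..<3::nat}. of_int (sign \<sigma>) * f (\<sigma> 0) (\<sigma> 1) (\<sigma> 2)) =
   (f 0 1 2 - f 0 2 1 - f 1 0 2 + f 1 2 0 + f 2 0 1 - f 2 1 0 :: 'c::comm_ring_1)"
proof -
  have s: "{..<3::nat} = {0, 1, 2}" by auto
  have f: "finite {1,2::nat}" "0 \<notin> {1, 2::nat}" "finite {2::nat}" "1 \<notin> {2::nat}" by auto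
  show ?thesis
    unfolding s sum_over_permutations_insert[OF f(1,2)] sum_over_permutations_insert[OF f(3,4)]
    by (simp add: permutes_sing sign_swap_id sign_compose permutation_swap_id transpose_def sign_id algebra_simps)
qed

lemma permutations_2:
  "(\<Sum>\<sigma> | \<sigma> permutes {..<2::nat}. of_int (sign \<sigma>) * f (\<sigma> 0) (\<sigma> 1)) =
   (f 0 1 - f 1 0 :: 'c::comm_ring_1)"
proof -
  have s: "{..<2::nat} = {0, 1}" by auto
  have f: "finite {1::nat}" "0 \<notin> {1::nat}" by auto
  show ?thesis
    unfolding s sum_over_permutations_insert[OF f(1,2)]
    by (simp add: permutes_sing sign_swap_id sign_id)
qed

text \<open>
  The following three lemmas carry out the antisymmetrisation. When one factor is an alternating
  2-form, the six permutations fall into three pairs of equal terms, which cancels the factor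
  \<open>1 / (fact 2 * fact 1)\<close> of the definition.
\<close>
lemma wedge_1_1:
  assumes "\<And>v. A p v = a (v 0)" "\<And>v. A' p v = a' (v 0)"
  shows "wedge 1 1 A A' p v = a (v 0) * a' (v 1) - a (v 1) * a' (v 0)"
  using permutations_2[of "\<lambda>i j. a (v i) * a' (v j)"]
  by (simp add: wedge_def assms mult.assoc numeral_2_eq_2)

lemma wedge_2_1:
  fixes A :: "('a, 'c::real_normed_field) form"
  assumes "\<And>v. A p v = a (v 0) (v 1)" "\<And>x y. a y x = - a x y" "\<And>v. A' p v = a' (v 0)"
  shows "wedge 2 1 A A' p v =
    a (v 0) (v 1) * a' (v 2) - a (v 0) (v 2) * a' (v 1) + a (v 1) (v 2) * a' (v 0)"
proof -
  have "wedge 2 1 A A' p v = (\<Sum>\<sigma> | \<sigma> permutes {..<3::nat}.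
      of_int (sign \<sigma>) * (a (v (\<sigma> 0)) (v (\<sigma> 1)) * a' (v (\<sigma> 2)))) / 2"
    by (simp add: wedge_def assms(1,3) mult.assoc numeral_2_eq_2 numeral_3_eq_3)
  also have "\<dots> = a (v 0) (v 1) * a' (v 2) - a (v 0) (v 2) * a' (v 1) + a (v 1) (v 2) * a' (v 0)"
    unfolding permutations_3[of "\<lambda>i j k. a (v i) (v j) * a' (v k)"]
    using assms(2)[of "v 0" "v 1"] assms(2)[of "v 0" "v 2"] assms(2)[of "v 1" "v 2"]
    by (simp add: field_simps)
  finally show ?thesis .
qed

lemma wedge_1_2:
  fixes A :: "('a, 'c::real_normed_field) form"
  assumes "\<And>v. A p v = a (v 0)" "\<And>v. A' p v = a' (v 0) (v 1)" "\<And>x y. a' y x = - a' x y"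
  shows "wedge 1 2 A A' p v =
    a (v 0) * a' (v 1) (v 2) - a (v 1) * a' (v 0) (v 2) + a (v 2) * a' (v 0) (v 1)"
proof -
  have "wedge 1 2 A A' p v = (\<Sum>\<sigma> | \<sigma> permutes {..<3::nat}.
      of_int (sign \<sigma>) * (a (v (\<sigma> 0)) * a' (v (\<sigma> 1)) (v (\<sigma> 2)))) / 2"
    by (simp add: wedge_def assms(1,2) mult.assoc numeral_2_eq_2 numeral_3_eq_3)
  also have "\<dots> = a (v 0) * a' (v 1) (v 2) - a (v 1) * a' (v 0) (v 2) + a (v 2) * a' (v 0) (v 1)"
    unfolding permutations_3[of "\<lambda>i j k. a (v i) * a' (v j) (v k)"]
    using assms(3)[of "v 0" "v 1"] assms(3)[of "v 0" "v 2"] assms(3)[of "v 1" "v 2"]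
    by (simp add: field_simps)
  finally show ?thesis .
qed

section \<open>Inverse matrices\<close>
lemma matrix_inv_unique:
  fixes A B :: "'a::field^'n^'n"
  assumes "A ** B = mat 1"
  shows "matrix_inv A = B"
proof -
  have BA: "B ** A = mat 1" using assms by (simp add: matrix_left_right_inverse)
  have "A ** matrix_inv A = mat 1 \<and> matrix_inv A ** A = mat 1"
    unfolding matrix_inv_def by (rule someI[of _ B]) (use assms BA in simp)
  then have "B ** (A ** matrix_inv A) = B" by simp
  then show ?thesis by (simp add: matrix_mul_assoc BA)
qed

lemma matrix_inv_mult:
  fixes A :: "'a::field^'n^'n"
  assumes "det A \<noteq> 0"
  shows "A ** matrix_inv A = mat 1" "matrix_inv A ** A = mat 1"
  using assms matrix_inv_unique unfolding invertible_det_nz[symmetric] invertible_def by metis+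

lemma det_matrix_inv:
  fixes A :: "'a::field^'n^'n"
  assumes "det A \<noteq> 0"
  shows "det (matrix_inv A) = 1 / det A"
  using arg_cong[OF matrix_inv_mult(1)[OF assms], of det] assms by (simp add: det_mul field_simps)

section \<open>The complex structure and the Kaehler metric\<close>

text \<open>The real \<open>\<real>\<^sup>2\<close>-valued form \<open>\<tau>\<close> with \<open>\<theta>\<^sub>j = i \<tau>\<^sub>j\<close>; it restricts to \<open>d\<phi>\<close> on torus orbits.\<close>
definition connection_form :: "(base_pt \<Rightarrow> complex^2) \<Rightarrow> pt \<Rightarrow> pt \<Rightarrow> real^2" where
  "connection_form \<alpha> p v = (\<chi> j. fst v $ j + 2 * Im (\<alpha> (snd p) $ j * fst (snd v)))"

lemma theta_eq: "theta \<alpha> j p v = \<i> * of_real (connection_form \<alpha> p (v 0) $ j)"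
  by (simp add: theta_def dcoord connection_form_def complex_eq_iff)

lemma omega_eq:
  "omega W \<alpha> p v = of_real (
     det (matrix_inv (W (snd p))) *
       (Re (fst (snd (v 0))) * Im (fst (snd (v 1))) - Im (fst (snd (v 0))) * Re (fst (snd (v 1)))) +
     connection_form \<alpha> p (v 0) \<bullet> snd (snd (v 1)) - connection_form \<alpha> p (v 1) \<bullet> snd (snd (v 0)))"
proof -
  have 1: "wedge 1 1 du du_bar p v = fst (snd (v 0)) * cnj (fst (snd (v 1))) -
      fst (snd (v 1)) * cnj (fst (snd (v 0)))"
    by (rule wedge_1_1) (simp_all add: dcoord)
  have 2: "wedge 1 1 (theta \<alpha> j) (dt j) p v =
      \<i> * of_real (connection_form \<alpha> p (v 0) $ j) * of_real (snd (snd (v 1)) $ j) -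
      \<i> * of_real (connection_form \<alpha> p (v 1) $ j) * of_real (snd (snd (v 0)) $ j)" for j
    by (rule wedge_1_1) (simp_all add: dcoord theta_eq)
  show ?thesis
    unfolding omega_def 1 2
    by (simp add: complex_eq_iff sum_2 inner_vec_def field_simps)
qed

text \<open>The values of the three (1,0)-forms \<open>(M dt)\<^sub>j - i \<tau>\<^sub>j\<close> and \<open>du\<close> whose product is \<open>-\<Omega>\<close>.\<close>
definition holomorphic_coframe ::
    "(base_pt \<Rightarrow> real^2^2) \<Rightarrow> (base_pt \<Rightarrow> complex^2) \<Rightarrow> pt \<Rightarrow> pt \<Rightarrow> complex^3" where
  "holomorphic_coframe W \<alpha> p v = vector
     [Complex ((matrix_inv (W (snd p)) *v snd (snd v)) $ 1) (- connection_form \<alpha> p v $ 1),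
      Complex ((matrix_inv (W (snd p)) *v snd (snd v)) $ 2) (- connection_form \<alpha> p v $ 2),
      fst (snd v)]"

lemma Omega_eq_det:
  "Omega W \<alpha> p v = - det (vector [holomorphic_coframe W \<alpha> p (v 0),
     holomorphic_coframe W \<alpha> p (v 1), holomorphic_coframe W \<alpha> p (v 2)])"
proof -
  let ?Z = "holomorphic_coframe W \<alpha> p"
  have E: "Omega_factor W \<alpha> 1 p v = ?Z (v 0) $ 1" "Omega_factor W \<alpha> 2 p v = ?Z (v 0) $ 2" for v
    by (simp_all add: Omega_factor_def holomorphic_coframe_def theta_eq dcoord sum_2
        matrix_vector_mult_def complex_eq_iff)
  have 1: "wedge 1 1 (Omega_factor W \<alpha> 1) (Omega_factor W \<alpha> 2) p v =
     ?Z (v 0) $ 1 * ?Z (v 1) $ 2 - ?Z (v 1) $ 1 * ?Z (v 0) $ 2" for v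
    by (rule wedge_1_1) (simp_all add: E)
  have 2: "du p v = ?Z (v 0) $ 3" for v by (simp add: dcoord holomorphic_coframe_def)
  have "wedge 2 1 (wedge 1 1 (Omega_factor W \<alpha> 1) (Omega_factor W \<alpha> 2)) du p v =
     (?Z (v 0) $ 1 * ?Z (v 1) $ 2 - ?Z (v 1) $ 1 * ?Z (v 0) $ 2) * ?Z (v 2) $ 3 -
     (?Z (v 0) $ 1 * ?Z (v 2) $ 2 - ?Z (v 2) $ 1 * ?Z (v 0) $ 2) * ?Z (v 1) $ 3 +
     (?Z (v 1) $ 1 * ?Z (v 2) $ 2 - ?Z (v 2) $ 1 * ?Z (v 1) $ 2) * ?Z (v 0) $ 3"
    by (rule wedge_2_1[where a = "\<lambda>x y. ?Z x $ 1 * ?Z y $ 2 - ?Z y $ 1 * ?Z x $ 2"])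
      (simp_all only: 1 2 minus_diff_eq)
  then show ?thesis
    by (simp add: Omega_def det_3 algebra_simps)
qed

lemma linear_holomorphic_coframe: "linear (holomorphic_coframe W \<alpha> p)"
  by (rule linearI)
     (simp_all add: holomorphic_coframe_def connection_form_def vec_eq_iff forall_3 complex_eq_iff
       matrix_vector_right_distrib matrix_vector_mult_scaleR algebra_simps)

text \<open>
  The preimage of \<open>c\<close> is found by reading off \<open>u = c\<^sub>3\<close>, then \<open>M dt = Re (c\<^sub>1, c\<^sub>2)\<close>,
  then \<open>\<tau> = - Im (c\<^sub>1, c\<^sub>2)\<close>.
\<close>
lemma bij_holomorphic_coframe:
  assumes "det (W (snd p)) \<noteq> 0"
  shows "bij (holomorphic_coframe W \<alpha> p)"
proof (rule bijI)
  let ?Z = "holomorphic_coframe W \<alpha> p" and ?M = "matrix_inv (W (snd p))"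
  note inv = matrix_inv_mult[OF assms]
  have "v = 0" if "?Z v = 0" for v
  proof -
    have u: "fst (snd v) = 0" and \<tau>: "connection_form \<alpha> p v = 0" and t: "?M *v snd (snd v) = 0"
      using that by (simp_all add: holomorphic_coframe_def vec_eq_iff forall_3 forall_2 complex_eq_iff)
    have "snd (snd v) = W (snd p) *v (?M *v snd (snd v))"
      by (simp add: matrix_vector_mul_assoc inv)
    then have "snd (snd v) = 0" by (simp add: t)
    moreover have "fst v = 0"
      using \<tau> u by (simp add: connection_form_def vec_eq_iff)
    ultimately show ?thesis using u by (simp add: prod_eq_iff)
  qed
  then show "inj ?Z"
    by (simp add: linear_injective_0[OF linear_holomorphic_coframe])
  show "surj ?Z"
  proof (rule surjI)
    fix c :: "complex^3"
    let ?v = "(vector [- Im (c $ 1), - Im (c $ 2)] - (\<chi> j. 2 * Im (\<alpha> (snd p) $ j * c $ 3)), c $ 3,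
       W (snd p) *v vector [Re (c $ 1), Re (c $ 2)])"
    have "?M *v (W (snd p) *v x) = x" for x by (simp add: matrix_vector_mul_assoc inv)
    then show "?Z ?v = c"
      by (simp add: holomorphic_coframe_def connection_form_def vec_eq_iff forall_3 complex_eq_iff)
  qed
qed

text \<open>
  The determinant is nondegenerate, so \<open>\<Omega>\<close> is \<open>J\<close>-linear in its first argument exactly when the
  coframe is. By injectivity of the coframe, such a \<open>J\<close> is unique and inherits
  linearity and \<open>J\<^sup>2 = -1\<close> from multiplication by \<open>i\<close>.
\<close>
lemma complex_structure_characterization:
  assumes W: "det (W (snd p)) \<noteq> 0"
    and J: "\<And>v. holomorphic_coframe W \<alpha> p (J v) = \<i> *s holomorphic_coframe W \<alpha> p v"
  shows "complex_structure (Omega W \<alpha>) p = J"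
proof -
  let ?Z = "holomorphic_coframe W \<alpha> p"
  have inj: "inj ?Z" and surj: "surj ?Z"
    using bij_holomorphic_coframe[of W p \<alpha>] W by (auto simp: bij_def)
  note lin = linear_holomorphic_coframe[of W \<alpha> p]
  have type: "(\<forall>x v. Omega W \<alpha> p (case_nat (K x) v) = \<i> * Omega W \<alpha> p (case_nat x v)) \<longleftrightarrow>
     (\<forall>x. ?Z (K x) = \<i> *s ?Z x)" for K
  proof
    assume "\<forall>x. ?Z (K x) = \<i> *s ?Z x"
    then show "\<forall>x v. Omega W \<alpha> p (case_nat (K x) v) = \<i> * Omega W \<alpha> p (case_nat x v)"
      by (simp add: Omega_eq_det det_3 algebra_simps)
  next
    assume K: "\<forall>x v. Omega W \<alpha> p (case_nat (K x) v) = \<i> * Omega W \<alpha> p (case_nat x v)"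
    show "\<forall>x. ?Z (K x) = \<i> *s ?Z x"
    proof
      fix x
      have D: "det (vector [?Z (K x), c, d] :: complex^3^3) = \<i> * det (vector [?Z x, c, d] :: complex^3^3)"
        for c d
      proof -
        obtain y z where "?Z y = c" "?Z z = d" using surj by (metis surj_def)
        then show ?thesis
          using K[rule_format, of x "case_nat y (\<lambda>_. z)"] by (simp add: Omega_eq_det numeral_2_eq_2)
      qed
      \<comment> \<open>With two standard basis vectors as last arguments, the determinant picks out a coordinate
        of the first.\<close>
      show "?Z (K x) = \<i> *s ?Z x"
        using D[of "axis 2 1" "axis 3 1"] D[of "axis 3 1" "axis 1 1"] D[of "axis 1 1" "axis 2 1"]
        by (simp add: det_3 axis_def vec_eq_iff forall_3)
    qed
  qed
  show ?thesis
    unfolding complex_structure_def type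
  proof (rule the_equality)
    have "linear J"
    proof (rule linearI)
      show "J (x + y) = J x + J y" for x y
        by (rule injD[OF inj]) (simp add: J linear_add[OF lin] vec.scale_right_distrib)
      show "J (r *\<^sub>R x) = r *\<^sub>R J x" for r x
        by (rule injD[OF inj]) (simp add: J linear_scale[OF lin] vec_eq_iff)
    qed
    moreover have "J (J v) = - v" for v
      by (rule injD[OF inj]) (simp add: J linear_neg[OF lin] vec_eq_iff)
    ultimately show "linear J \<and> (\<forall>v. J (J v) = - v) \<and> (\<forall>x. ?Z (J x) = \<i> *s ?Z x)"
      using J by blast
  next
    fix K
    assume "linear K \<and> (\<forall>v. K (K v) = - v) \<and> (\<forall>x. ?Z (K x) = \<i> *s ?Z x)"
    then have "?Z (K x) = ?Z (J x)" for x unfolding J by blast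
    then show "K = J" by (intro ext injD[OF inj])
  qed
qed

lemma complex_structure_Omega:
  assumes "det (W (snd p)) \<noteq> 0"
  shows "complex_structure (Omega W \<alpha>) p = (\<lambda>v.
    (- (matrix_inv (W (snd p)) *v snd (snd v)) - (\<chi> j. 2 * Re (\<alpha> (snd p) $ j * fst (snd v))),
     \<i> * fst (snd v), W (snd p) *v connection_form \<alpha> p v))"
proof (rule complex_structure_characterization[of W p, OF assms])
  fix v
  let ?Jv = "(- (matrix_inv (W (snd p)) *v snd (snd v)) - (\<chi> j. 2 * Re (\<alpha> (snd p) $ j * fst (snd v))),
     \<i> * fst (snd v), W (snd p) *v connection_form \<alpha> p v)"
  have t: "matrix_inv (W (snd p)) *v snd (snd ?Jv) = connection_form \<alpha> p v"
    by (simp add: matrix_vector_mul_assoc matrix_inv_mult[OF assms])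
  have \<tau>: "connection_form \<alpha> p ?Jv = - (matrix_inv (W (snd p)) *v snd (snd v))"
    by (simp add: connection_form_def vec_eq_iff)
  have u: "fst (snd ?Jv) = \<i> * fst (snd v)" by simp
  show "holomorphic_coframe W \<alpha> p ?Jv = \<i> *s holomorphic_coframe W \<alpha> p v"
    unfolding holomorphic_coframe_def t \<tau> u
    by (simp add: vec_eq_iff forall_3 complex_eq_iff)
qed

text \<open>
  In \<open>\<omega>(v, J w)\<close> the relation \<open>du \<circ> J = i du\<close> turns \<open>dx \<and> dy\<close> into the Euclidean inner product on
  \<open>\<complex>\<close>, and of the two terms of \<open>\<Sum>\<^sub>j \<tau>\<^sub>j \<and> dt\<^sub>j\<close> one becomes the summand in \<open>\<tau>\<close>, by
  \<open>dt \<circ> J = W \<tau>\<close>, and the other the summand in \<open>dt\<close>, by \<open>\<tau> \<circ> J = - M dt\<close>.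
\<close>
lemma kaehler_metric_eq:
  assumes "det (W (snd p)) \<noteq> 0"
  shows "kaehler_metric (Omega W \<alpha>) (omega W \<alpha>) p v w =
    connection_form \<alpha> p v \<bullet> (W (snd p) *v connection_form \<alpha> p w) +
    fst (snd v) \<bullet> fst (snd w) / det (W (snd p)) +
    snd (snd v) \<bullet> (matrix_inv (W (snd p)) *v snd (snd w))"
proof -
  have "connection_form \<alpha> p (complex_structure (Omega W \<alpha>) p w) =
      - (matrix_inv (W (snd p)) *v snd (snd w))"
    unfolding complex_structure_Omega[of W p, OF assms] by (simp add: connection_form_def vec_eq_iff)
  moreover have "fst (snd (complex_structure (Omega W \<alpha>) p w)) = \<i> * fst (snd w)"
    "snd (snd (complex_structure (Omega W \<alpha>) p w)) = W (snd p) *v connection_form \<alpha> p w"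
    unfolding complex_structure_Omega[of W p, OF assms] by simp_all
  ultimately show ?thesis
    unfolding kaehler_metric_def omega_eq det_matrix_inv[OF assms]
    by (simp add: inner_complex_def inner_commute add_divide_distrib)
qed


section \<open>The metric on a fibre\<close>

text \<open>
  The rows are the coordinate expressions of \<open>\<tau>\<^sub>1\<close>, \<open>\<tau>\<^sub>2\<close> and \<open>(det W)\<^sup>-\<^sup>1 dx\<close>; multiplying by this
  matrix takes a tangent vector to its components in the frame \<open>(\<eta>\<^sub>1, \<eta>\<^sub>2, \<zeta>)\<close>.
\<close>
definition fibre_coframe ::
    "(base_pt \<Rightarrow> real^2^2) \<Rightarrow> (base_pt \<Rightarrow> complex^2) \<Rightarrow> real^3 \<Rightarrow> real^3 \<Rightarrow> real^3^3" where
  "fibre_coframe W \<alpha> b s = (let q = snd (fibre_emb b s) in vector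
     [vector [1, 0, 2 * Im (\<alpha> q $ 1)],
      vector [0, 1, 2 * Im (\<alpha> q $ 2)],
      vector [0, 0, 1 / det (W q)]])"

lemma frechet_derivative_fibre_emb:
  "frechet_derivative (fibre_emb b) (at s) v = (vector [v $ 1, v $ 2], of_real (v $ 3), 0)"
proof -
  let ?L = "\<lambda>v :: real^3. (vector [v $ 1, v $ 2] :: real^2, of_real (v $ 3) :: complex, 0 :: real^2)"
  have "linear ?L"
    by (rule linearI) (simp_all add: vec_eq_iff forall_2 complex_eq_iff)
  then have "(?L has_derivative ?L) (at s)"
    by (rule linear_imp_has_derivative)
  from has_derivative_add[OF has_derivative_const[of "fibre_emb b 0"] this]
  have "((\<lambda>s. fibre_emb b 0 + ?L s) has_derivative ?L) (at s)"
    by simp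
  also have "(\<lambda>s. fibre_emb b 0 + ?L s) = fibre_emb b"
    by (simp add: fun_eq_iff fibre_emb_def vec_eq_iff forall_2 complex_eq_iff)
  finally show ?thesis by (simp add: frechet_derivative_at[symmetric])
qed

lemma connection_form_fibre:
  "connection_form \<alpha> (fibre_emb b s) (frechet_derivative (fibre_emb b) (at s) v) =
    vector [(fibre_coframe W \<alpha> b s *v v) $ 1, (fibre_coframe W \<alpha> b s *v v) $ 2]"
  by (simp add: connection_form_def frechet_derivative_fibre_emb fibre_coframe_def Let_def
      matrix_vector_mult_def vec_eq_iff forall_2 sum_3)

lemma block_metric_mult:
  "block_metric A *v x =
    vector [A $ 1 $ 1 * x $ 1 + A $ 1 $ 2 * x $ 2, A $ 2 $ 1 * x $ 1 + A $ 2 $ 2 * x $ 2, det A * x $ 3]"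
  by (simp add: vec_eq_iff forall_3 block_metric_def matrix_vector_mult_def sum_3)

text \<open>
  The third component of \<open>C v\<close> is \<open>v\<^sub>3 / det W\<close>, so the block \<open>det W\<close> reproduces the summand
  \<open>(det W)\<^sup>-\<^sup>1 dx\<^sup>2\<close> of the Kaehler metric.
\<close>
lemma fibre_metric_eq:
  assumes "det (W (snd (fibre_emb b s))) \<noteq> 0"
  shows "fibre_metric W \<alpha> b s v w =
    (fibre_coframe W \<alpha> b s *v v) \<bullet>
      (block_metric (W (snd (fibre_emb b s))) *v (fibre_coframe W \<alpha> b s *v w))"
proof -
  have x: "(fibre_coframe W \<alpha> b s *v v) $ 3 = v $ 3 / det (W (snd (fibre_emb b s)))" for v
    by (simp add: fibre_coframe_def Let_def matrix_vector_mult_def sum_3)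
  show ?thesis
    unfolding fibre_metric_def kaehler_metric_eq[of W "fibre_emb b s", OF assms]
      connection_form_fibre[where W = W]
    using assms
    by (simp add: frechet_derivative_fibre_emb inner_vec_def inner_complex_def sum_2 sum_3
        block_metric_mult
        matrix_vector_mult_def[of "W _"] x field_simps)
qed

lemma fibre_coframe_dual:
  assumes "det (W (snd (fibre_emb b s))) \<noteq> 0"
  shows "fibre_coframe W \<alpha> b s *v (fibre_frame W \<alpha> b s $ j) = axis j 1"
  using exhaust_3[of j] assms
  by (auto simp: fibre_coframe_def fibre_frame_def Let_def zeta_def eta_def sum_2 sum_3
      matrix_vector_mult_def vec_eq_iff forall_3 axis_def)

lemma inner_axis_matrix:
  fixes A :: "real^'n^'m"
  shows "axis i 1 \<bullet> (A *v axis j 1) = A $ i $ j"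
  by (simp add: inner_axis' matrix_vector_mul_component inner_axis)

lemma congruence_entry:
  fixes C :: "real^'n^'n"
  shows "(C *v axis i 1) \<bullet> (N *v (C *v axis j 1)) = (transpose C ** N ** C) $ i $ j"
proof -
  have "(C *v axis i 1) \<bullet> (N *v (C *v axis j 1)) =
      axis i 1 \<bullet> (transpose C *v (N *v (C *v axis j 1)))"
    by (metis dot_lmul_matrix inner_commute transpose_matrix_vector)
  then show ?thesis
    by (simp add: matrix_vector_mul_assoc inner_axis_matrix matrix_mul_assoc del: transpose_matrix_vector)
qed

lemma gram_fibre_metric:
  assumes "det (W (snd (fibre_emb b s))) \<noteq> 0"
  shows "gram (fibre_metric W \<alpha> b) s = transpose (fibre_coframe W \<alpha> b s) **
    block_metric (W (snd (fibre_emb b s))) ** fibre_coframe W \<alpha> b s"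
  by (simp add: gram_def vec_eq_iff fibre_metric_eq[of W b s, OF assms] congruence_entry)

lemma det_block_metric: "det (block_metric A) = (det A)\<^sup>2"
  by (simp add: block_metric_def det_3 det_2 power2_eq_square algebra_simps)

text \<open>
  The factors \<open>(det W)\<^sup>2\<close> from the block matrix and \<open>(det W)\<^sup>-\<^sup>2\<close> from the coframe cancel. This is
  why no density appears in the formula for McLean's metric.
\<close>
lemma det_gram_fibre_metric:
  assumes "det (W (snd (fibre_emb b s))) \<noteq> 0"
  shows "det (gram (fibre_metric W \<alpha> b) s) = 1"
proof -
  have "det (fibre_coframe W \<alpha> b s) = 1 / det (W (snd (fibre_emb b s)))"
    by (simp add: fibre_coframe_def Let_def det_3)
  then show ?thesis
    using assms
    by (simp add: gram_fibre_metric[of W b s, OF assms] det_mul det_transpose det_block_metric power2_eq_square)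
qed

section \<open>Pointwise inner products of the harmonic forms\<close>

text \<open>
  The change of basis rule for the inner product on covectors: if \<open>C\<close> is a coframe in which the
  metric has matrix \<open>G\<close>, then \<open>G\<^sup>-\<^sup>1\<close> is the matrix of the inner products of the rows of \<open>C\<close>.
\<close>
lemma matrix_inv_congruence:
  fixes C G :: "'a::field^'n^'n"
  assumes "det (transpose C ** G ** C) \<noteq> 0"
  shows "C ** matrix_inv (transpose C ** G ** C) ** transpose C = matrix_inv G"
proof -
  let ?N = "matrix_inv (transpose C ** G ** C)"
  have "transpose C ** (G ** C ** ?N) = mat 1"
    using matrix_inv_mult(1)[OF assms] by (simp add: matrix_mul_assoc)
  then have "G ** (C ** ?N ** transpose C) = mat 1"
    by (simp add: matrix_left_right_inverse matrix_mul_assoc)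
  then show ?thesis by (rule matrix_inv_unique[symmetric])
qed

text \<open>
  The contraction with \<open>\<partial>/\<partial>t\<^sub>j\<close> only meets \<open>\<tau>\<^sub>j \<and> dt\<^sub>j\<close>, and leaves \<open>- \<tau>\<^sub>j\<close>. The contraction with
  \<open>\<partial>/\<partial>y\<close> leaves \<open>- (det W)\<^sup>-\<^sup>1 dx\<close> and multiples of the \<open>dt\<^sub>j\<close>, which vanish on the fibre.
\<close>
lemma Xi_eq:
  assumes "det (W (snd (fibre_emb b s))) \<noteq> 0"
  shows "Xi W \<alpha> b j s v = - (fibre_coframe W \<alpha> b s $ j \<bullet> v 0)"
proof -
  let ?C = "fibre_coframe W \<alpha> b s"
  have C: "?C $ j \<bullet> v 0 = (?C *v v 0) $ j" by (simp add: matrix_vector_mul_component)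
  have x: "(?C *v v 0) $ 3 = v 0 $ 3 / det (W (snd (fibre_emb b s)))"
    by (simp add: fibre_coframe_def Let_def matrix_vector_mult_def sum_3)
  show ?thesis
    unfolding C Xi_def pullback_def interior_product_def omega_eq
      det_matrix_inv[OF assms]
    using exhaust_3[of j]
    by (auto simp: connection_form_fibre[where W = W] x)
       (auto simp: transverse_field_def frechet_derivative_fibre_emb inner_axis)
qed

text \<open>
  The identity \<open>b \<and> \<star>a = \<langle>b, a\<rangle> vol\<close> evaluated on the standard basis: expanding the wedge product
  is a cofactor expansion which recovers the coordinates of the vector dual to \<open>a\<close>.
\<close>
lemma wedge_hodge_star:
  assumes a: "\<And>v. a s v = c \<bullet> v 0" and a': "\<And>v. a' s v = c' \<bullet> v 0"
  shows "wedge 1 2 a (hodge_star h a') s ((!) [axis 1 1, axis 2 1, axis 3 1]) =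
    sqrt (det (gram h s)) * (c \<bullet> (matrix_inv (gram h s) *v c'))"
proof -
  let ?X = "matrix_inv (gram h s) *v c'"
  have "dual_vector_field h a' s = ?X"
    by (simp add: dual_vector_field_def a' inner_axis)
  then have star: "hodge_star h a' s v = sqrt (det (gram h s)) * det (vector [?X, v 0, v 1] :: real^3^3)" for v
    by (simp add: hodge_star_def interior_product_def volume_form_def numeral_2_eq_2)
  have "wedge 1 2 a (hodge_star h a') s v =
     (c \<bullet> v 0) * (sqrt (det (gram h s)) * det (vector [?X, v 1, v 2] :: real^3^3)) -
     (c \<bullet> v 1) * (sqrt (det (gram h s)) * det (vector [?X, v 0, v 2] :: real^3^3)) +
     (c \<bullet> v 2) * (sqrt (det (gram h s)) * det (vector [?X, v 0, v 1] :: real^3^3))" for v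
    by (rule wedge_1_2[where a' = "\<lambda>x y. sqrt (det (gram h s)) * det (vector [?X, x, y] :: real^3^3)"])
       (rule a, rule star, simp add: det_3 algebra_simps)
  then show ?thesis
    by (simp add: det_3 inner_axis inner_vec_def[of c ?X] sum_3)
       (simp add: axis_def algebra_simps)
qed

lemma Xi_inner:
  assumes "det (W (snd (fibre_emb b s))) \<noteq> 0"
  shows "wedge 1 2 (Xi W \<alpha> b j) (hodge_star (fibre_metric W \<alpha> b) (Xi W \<alpha> b k)) s
      ((!) [axis 1 1, axis 2 1, axis 3 1]) =
    matrix_inv (block_metric (W (snd (fibre_emb b s)))) $ j $ k"
proof -
  let ?C = "fibre_coframe W \<alpha> b s" and ?G = "block_metric (W (snd (fibre_emb b s)))"
  let ?g = "gram (fibre_metric W \<alpha> b) s"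
  have row: "?C $ i = transpose ?C *v axis i 1" for i
    by (simp add: matrix_vector_mult_basis column_def transpose_def del: transpose_matrix_vector)
  note g = gram_fibre_metric[of W b s \<alpha>, OF assms]
  note d = det_gram_fibre_metric[of W b s \<alpha>, OF assms]
  have "wedge 1 2 (Xi W \<alpha> b j) (hodge_star (fibre_metric W \<alpha> b) (Xi W \<alpha> b k)) s
      ((!) [axis 1 1, axis 2 1, axis 3 1]) =
      sqrt (det ?g) * ((- ?C $ j) \<bullet> (matrix_inv ?g *v (- ?C $ k)))"
    by (rule wedge_hodge_star) (simp_all add: Xi_eq[of W b s, OF assms])
  also have "\<dots> = ?C $ j \<bullet> (matrix_inv ?g *v ?C $ k)"
    by (simp add: d vec.neg)
  also have "\<dots> = (?C ** matrix_inv ?g ** transpose ?C) $ j $ k"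
    unfolding row congruence_entry by simp
  also have "\<dots> = matrix_inv ?G $ j $ k"
    using d unfolding g by (simp add: matrix_inv_congruence)
  finally show ?thesis .
qed

section \<open>Integration over the fibre\<close>
lemma matrix_inv_block_metric:
  assumes "det A \<noteq> 0"
  shows "matrix_inv (block_metric A) = vector
    [vector [A $ 2 $ 2 / det A, - A $ 1 $ 2 / det A, 0],
     vector [- A $ 2 $ 1 / det A, A $ 1 $ 1 / det A, 0],
     vector [0, 0, 1 / det A]]"
proof (rule matrix_inv_unique)
  show "block_metric A ** vector
    [vector [A $ 2 $ 2 / det A, - A $ 1 $ 2 / det A, 0],
     vector [- A $ 2 $ 1 / det A, A $ 1 $ 1 / det A, 0],
     vector [0, 0, 1 / det A]] = mat 1"
    by (simp add: vec_eq_iff forall_3 matrix_matrix_mult_def sum_3 block_metric_def mat_def assms field_simps)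
       (simp add: det_2 algebra_simps)
qed

lemma continuous_on_matrix_inv_block_metric:
  fixes A :: "'a::topological_space \<Rightarrow> real^2^2"
  assumes "continuous_on S A" and "\<And>x. x \<in> S \<Longrightarrow> det (A x) \<noteq> 0"
  shows "continuous_on S (\<lambda>x. matrix_inv (block_metric (A x)) $ j $ k)"
proof -
  have d: "continuous_on S (\<lambda>x. det (A x))"
    unfolding det_2 by (intro continuous_intros assms(1))
  have "continuous_on S (\<lambda>x. vector
    [vector [A x $ 2 $ 2 / det (A x), - A x $ 1 $ 2 / det (A x), 0],
     vector [- A x $ 2 $ 1 / det (A x), A x $ 1 $ 1 / det (A x), 0],
     vector [0, 0, 1 / det (A x)]] $ j $ k)"
    using exhaust_3[of j] exhaust_3[of k]
    by (elim disjE) (simp_all, (auto intro!: continuous_intros d assms)+)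
  then show ?thesis
    by (rule continuous_on_eq) (simp add: assms(2) matrix_inv_block_metric)
qed

text \<open>
  Fubini's theorem for products of functions of one coordinate, transported from the product measure
  on families indexed by \<open>Basis\<close> to Lebesgue measure.
\<close>
lemma lborel_integral_prod_Basis:
  fixes f :: "'a::euclidean_space \<Rightarrow> real \<Rightarrow> real"
  assumes "\<And>b. b \<in> Basis \<Longrightarrow> integrable lborel (f b)"
  shows "(\<integral>x. (\<Prod>b\<in>Basis. f b (x \<bullet> b)) \<partial>lborel) = (\<Prod>b\<in>Basis. \<integral>x. f b x \<partial>lborel)"
    and "integrable lborel (\<lambda>x. \<Prod>b\<in>Basis. f b (x \<bullet> b))"
proof -
  interpret product_sigma_finite "\<lambda>_::'a. lborel :: real measure" ..
  have m [measurable]: "f b \<in> borel_measurable borel" if "b \<in> Basis" for b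
    using borel_measurable_integrable[OF assms[OF that]] by simp
  have [measurable]: "(\<lambda>x :: 'a. \<Prod>b\<in>Basis. f b (x \<bullet> b)) \<in> borel_measurable borel"
    by measurable
  have [measurable]: "(\<lambda>y. \<Sum>b\<in>Basis. y b *\<^sub>R b) \<in> Pi\<^sub>M Basis (\<lambda>_::'a. lborel) \<rightarrow>\<^sub>M borel"
    by measurable
  have coord: "(\<Sum>b'\<in>Basis. y b' *\<^sub>R b') \<bullet> b = y b" if "b \<in> Basis" for y :: "'a \<Rightarrow> real" and b
    using that by simp
  show "(\<integral>x. (\<Prod>b\<in>Basis. f b (x \<bullet> b)) \<partial>lborel) = (\<Prod>b\<in>Basis. \<integral>x. f b x \<partial>lborel)"
    by (subst lborel_eq, subst integral_distr) (simp_all add: coord product_integral_prod assms del: inner_sum_left_Basis)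
  show "integrable lborel (\<lambda>x. \<Prod>b\<in>Basis. f b (x \<bullet> b))"
    by (subst lborel_eq, subst integrable_distr_eq) (simp_all add: coord product_integrable_prod assms del: inner_sum_left_Basis)
qed

text \<open>
  Extended by zero off the box, the integrand is the product of the indicators of \<open>[0,1]\<close> in the
  two angles and of \<open>f\<close> cut off to \<open>[0,c]\<close> in the third coordinate.
\<close>
lemma integral_box_third_coordinate:
  fixes f :: "real \<Rightarrow> real"
  assumes f: "continuous_on {0..c} f"
  shows "integral (cbox 0 (vector [1, 1, c] :: real^3)) (\<lambda>s. f (s $ 3)) = integral {0..c} f"
proof -
  define h where "h b = (if b = axis 3 1 then (\<lambda>x. indicator {0..c} x * f x) else indicator {0..1})"
    for b :: "real^3"
  have f_int: "set_integrable lborel {0..c} f"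
    by (rule borel_integrable_atLeastAtMost') (rule f)
  have basis: "(Basis :: (real^3) set) = {axis 1 1, axis 2 1, axis 3 1}"
    by (auto simp: Basis_vec_def UNIV_3)
  have ne: "axis 1 1 \<noteq> (axis 2 1 :: real^3)" "axis 1 1 \<noteq> (axis 3 1 :: real^3)" "axis 2 1 \<noteq> (axis 3 1 :: real^3)"
    by (simp_all add: axis_eq_axis)
  have h_int: "integrable lborel (h b)" for b
    using f_int by (simp add: h_def set_integrable_def integrable_indicator_iff)
  have prod_h: "(\<Prod>b\<in>Basis. h b (s \<bullet> b)) =
      indicator (cbox 0 (vector [1, 1, c])) s *\<^sub>R f (s $ 3)" for s :: "real^3"
    using ne by (simp add: basis h_def inner_axis mem_box_cart forall_3 indicator_def)
  have "set_integrable lborel (cbox 0 (vector [1, 1, c])) (\<lambda>s :: real^3. f (s $ 3))"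
    using lborel_integral_prod_Basis(2)[of h, OF h_int]
    by (simp add: prod_h set_integrable_def)
  from set_borel_integral_eq_integral(2)[OF this]
  have "integral (cbox 0 (vector [1, 1, c] :: real^3)) (\<lambda>s. f (s $ 3)) =
      (\<integral>s. (\<Prod>b\<in>Basis. h b (s \<bullet> b)) \<partial>lborel)"
    by (simp add: prod_h set_lebesgue_integral_def)
  also have "\<dots> = (\<Prod>b\<in>Basis. \<integral>x. h b x \<partial>lborel)"
    by (rule lborel_integral_prod_Basis(1)) (rule h_int)
  also have "\<dots> = (\<integral>x. indicator {0..c} x *\<^sub>R f x \<partial>lborel)"
    using ne by (simp add: basis h_def)
  also have "\<dots> = integral {0..c} f"
    using set_borel_integral_eq_integral(2)[OF f_int] by (simp add: set_lebesgue_integral_def)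
  finally show ?thesis .
qed

lemma det_nonzero_if_positive:
  fixes A :: "real^'n^'n"
  assumes "\<And>v. v \<noteq> 0 \<Longrightarrow> v \<bullet> (A *v v) > 0"
  shows "det A \<noteq> 0"
proof -
  have "x = 0" if "A *v x = 0" for x
    using assms[of x] that by fastforce
  then show ?thesis
    by (metis matrix_left_invertible_ker invertible_left_inverse invertible_det_nz)
qed

section \<open>The fibre metric and McLean's metric\<close>
theorem theorem8:
  fixes B :: "(real^3) set" and \<kappa> :: real and b :: "real^3"
    and W :: "base_pt \<Rightarrow> real^2^2" and \<alpha> :: "base_pt \<Rightarrow> complex^2"
  assumes "open B" and "\<kappa> > 0"
    and "smooth_on (moment_base B) W" and "smooth_on (moment_base B) \<alpha>"
    and "\<And>q. q \<in> moment_base B \<Longrightarrow> transpose (W q) = W q"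
    and "\<And>q v. q \<in> moment_base B \<Longrightarrow> v \<noteq> 0 \<Longrightarrow> v \<bullet> (W q *v v) > 0"
    and "\<And>u t. (u, t) \<in> moment_base B \<Longrightarrow> W (u + of_real \<kappa>, t) = W (u, t)"
    and "\<And>u t. (u, t) \<in> moment_base B \<Longrightarrow> \<alpha> (u + of_real \<kappa>, t) = \<alpha> (u, t)"
    and "calabi_yau3 (total_space B) (Omega W \<alpha>) (omega W \<alpha>)"
    and "b \<in> B"
  shows "(\<forall>s. (\<chi> j k. fibre_metric W \<alpha> b s (fibre_frame W \<alpha> b s $ j) (fibre_frame W \<alpha> b s $ k))
              = block_metric (W (snd (fibre_emb b s)))) \<and>
         mclean_metric \<kappa> W \<alpha> b =
           (\<chi> j k. integral {0..\<kappa>}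
              (\<lambda>x. matrix_inv (block_metric (W (Complex x (b $ 3), vector [b $ 1, b $ 2]))) $ j $ k))"
proof (intro conjI allI)
  let ?q = "\<lambda>x. (Complex x (b $ 3), vector [b $ 1, b $ 2]) :: base_pt"
  have fibre: "snd (fibre_emb b s) = ?q (s $ 3)" for s
    by (simp add: fibre_emb_def)
  have "vector [b $ 1, b $ 2, b $ 3] = b" by (simp add: vec_eq_iff forall_3)
  with \<open>b \<in> B\<close> have q: "?q x \<in> moment_base B" for x
    by (simp add: moment_base_def)
  have det: "det (W (?q x)) \<noteq> 0" for x
    using assms(6)[OF q] by (rule det_nonzero_if_positive)
  have det_fibre: "det (W (snd (fibre_emb b s))) \<noteq> 0" for s
    unfolding fibre by (rule det)
  show "(\<chi> j k. fibre_metric W \<alpha> b s (fibre_frame W \<alpha> b s $ j) (fibre_frame W \<alpha> b s $ k))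
      = block_metric (W (snd (fibre_emb b s)))" for s
    by (simp add: vec_eq_iff fibre_metric_eq[of W b s, OF det_fibre]
        fibre_coframe_dual[of W b s, OF det_fibre] inner_axis_matrix)
  \<comment> \<open>The integrals of the claim are those of continuous functions of \<open>x\<close>, so Fubini applies.\<close>
  have "continuous_on (moment_base B) W"
    using assms(3) Ck_on.simps(1) unfolding smooth_on_def by blast
  moreover have "continuous_on UNIV ?q"
    unfolding Complex_eq by (intro continuous_intros)
  ultimately have "continuous_on UNIV (\<lambda>x. W (?q x))"
    using continuous_on_compose2 q by blast
  then have "continuous_on {0..\<kappa>} (\<lambda>x. matrix_inv (block_metric (W (?q x))) $ j $ k)" for j k
    by (intro continuous_on_matrix_inv_block_metric det) (rule continuous_on_subset, auto)
  note integral_box_third_coordinate[OF this]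
  moreover have "L2_inner \<kappa> W \<alpha> b (Xi W \<alpha> b j) (Xi W \<alpha> b k) =
      integral (cbox 0 (vector [1, 1, \<kappa>])) (\<lambda>s :: real^3. matrix_inv (block_metric (W (?q (s $ 3)))) $ j $ k)" for j k
    unfolding L2_inner_def fibre_integral_def Xi_inner[of W b, OF det_fibre] fibre ..
  ultimately show "mclean_metric \<kappa> W \<alpha> b =
      (\<chi> j k. integral {0..\<kappa>} (\<lambda>x. matrix_inv (block_metric (W (?q x))) $ j $ k))"
    by (simp add: mclean_metric_def)
qed

end
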